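(* Let $A$ be a finite local ring (commutative, unitary, with a unique maximal ideal), let $U(A)$ denote its group of units, and let $n \geq 3$. Set $\omega=\sqrt{|U(A)|^{2}+4\,|A\setminus U(A)|\,|A|}$, $\eta=\frac{|U(A)|+\omega}{2}$ and $\tau=\frac{|U(A)|-\omega}{2}$. Then \[\sum_{v \in U(A)} w_{n}^{v}(A)=\frac{|U(A)|\,\omega\,(\tau^{n-3}+\eta^{n-3})+\left(2|A\setminus U(A)|\,|A|+|U(A)|^{2}\right)(\eta^{n-3}-\tau^{n-3})}{2\omega}.\]
   Context: For a commutative unitary ring $A$ and $(a_1,\dots,a_n)\in A^n$, set $M_{n}(a_1,\ldots,a_n):=\begin{pmatrix} a_{n} & -1_{A} \\ 1_{A} & 0_{A}\end{pmatrix}\begin{pmatrix} a_{n-1} & -1_{A} \\ 1_{A} & 0_{A}\end{pmatrix}\cdots\begin{pmatrix} a_{1} & -1_{A} \\ 1_{A} & 0_{A}\end{pmatrix}$. For $B\in SL_2(A)$ let $\Omega_{n}^{B}(A):=\{(a_{1},\ldots,a_{n}) \in A^{n} : M_{n}(a_{1},\ldots,a_{n})=B\}$, and for a unit $u\in U(A)$ let $w_{n}^{u}(A):=|\Omega_{n}^{B}(A)|$ where $B=\begin{pmatrix} u & 0_A\\ 0_A & u^{-1}\end{pmatrix}$. *)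

theory Defs
  imports "HOL-Analysis.Determinants" "HOL-Algebra.Algebraic_Closure_Type"
begin

definition local_ring :: "'a::comm_ring_1 itself \<Rightarrow> bool"
  where "local_ring _ \<longleftrightarrow> (\<exists>!I. maximalideal I (ring_of_type_algebra :: 'a ring))"

definition ring_units :: "'a::comm_ring_1 set"
  where "ring_units = {u. u dvd 1}"

definition unit_inv :: "'a::comm_ring_1 \<Rightarrow> 'a"
  where "unit_inv u = (THE v. u * v = 1)"

definition elem_mat :: "'a::comm_ring_1 \<Rightarrow> 'a^2^2"
  where "elem_mat a = vector [vector [a, -1], vector [1, 0]]"

text \<open>Tuples $(a_1,\ldots,a_n)$ are lists of length $n$ whose head is $a_1$; the factor belonging
  to the head is the rightmost one of the product.\<close>
fun cont_mat :: "'a::comm_ring_1 list \<Rightarrow> 'a^2^2"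
  where
    "cont_mat [] = mat 1"
  | "cont_mat (a # as) = cont_mat as ** elem_mat a"

definition Omega :: "nat \<Rightarrow> 'a::comm_ring_1^2^2 \<Rightarrow> 'a list set"
  where "Omega n B = {as. length as = n \<and> cont_mat as = B}"

definition w :: "nat \<Rightarrow> 'a::comm_ring_1 \<Rightarrow> nat"
  where "w n u = card (Omega n (vector [vector [u, 0], vector [0, unit_inv u]]))"

end

theory Submission
  imports Defs
begin

text \<open>
  By the determinant condition, the sum counts the tuples whose matrix is diagonal. Write such a
  tuple as a first entry a, an inner tuple with matrix N = ((p, q), (r, s)) and a last entry b. The
  off-diagonal entries of the full matrix are r - b p and p a + q. If p is a unit, exactly one pair
  (a, b) makes both vanish. If p is not a unit, then q is one because det N = 1 and the ring is
  local, and p a + q cannot vanish. Hence the sum is the number of tuples of length n - 2 whose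
  matrix has a unit as its upper left entry. Prepending an entry a replaces (p, q) by
  (p a + q, -p), so the same dichotomy gives a linear recurrence for this number. Moreover
  \<omega> = |A| + |A \ U|, so the numbers \<eta> and \<tau> are |A| and - |A \ U|.
\<close>

subsection \<open>Units of a finite local ring\<close>

text \<open>The principal ideal of a non-unit is proper. The ring is finite, so the set
  \<open>S\<close> of proper ideals is finite and has a maximal element above that ideal.\<close>

lemma nonunit_in_maximalideal:
  fixes x :: "'a::{comm_ring_1,finite}"
  assumes "\<not> x dvd 1"
  shows "\<exists>I. maximalideal I (ring_of_type_algebra :: 'a ring) \<and> x \<in> I"
proof -
  let ?R = "ring_of_type_algebra :: 'a ring"
  interpret R: cring ?R by (rule cring_from_type_algebra)
  have car: "carrier ?R = UNIV" and mult: "mult ?R = (*)"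
    by (simp_all add: ring_of_type_algebra_def)
  define S where "S = {J. ideal J ?R \<and> J \<noteq> UNIV}"
  have "1 \<notin> PIdl\<^bsub>?R\<^esub> x"
    using assms by (auto simp: cgenideal_def car mult dvd_def mult.commute)
  then have "PIdl\<^bsub>?R\<^esub> x \<in> S"
    using R.cgenideal_ideal[of x] by (auto simp: S_def car)
  then obtain I where I: "I \<in> S" "PIdl\<^bsub>?R\<^esub> x \<subseteq> I" "\<And>J. J \<in> S \<Longrightarrow> I \<subseteq> J \<Longrightarrow> J = I"
    using finite_has_maximal2[of S "PIdl\<^bsub>?R\<^esub> x"] by auto
  have "maximalideal I ?R"
    using I by (intro maximalidealI) (auto simp: S_def car)
  moreover have "x \<in> I"
    using R.cgenideal_self[of x] I(2) by (auto simp: car)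
  ultimately show ?thesis by blast
qed

text \<open>Two non-units would both lie in the unique maximal ideal, which would then contain their
  sum and, the sum being a unit, also 1.\<close>

lemma local_ring_add_unit:
  fixes x y :: "'a::{comm_ring_1,finite}"
  assumes "local_ring TYPE('a)" and "x + y dvd 1"
  shows "x dvd 1 \<or> y dvd 1"
proof (rule ccontr)
  let ?R = "ring_of_type_algebra :: 'a ring"
  assume "\<not> (x dvd 1 \<or> y dvd 1)"
  then obtain I where I: "maximalideal I ?R" "x \<in> I" "y \<in> I"
    using nonunit_in_maximalideal[of x] nonunit_in_maximalideal[of y] assms(1)
    unfolding local_ring_def by metis
  interpret maximalideal I ?R by (rule I(1))
  have "x + y \<in> I"
    using additive_subgroup.a_closed[OF additive_subgroup_axioms I(2,3)] by (simp add: ring_of_type_algebra_def)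
  moreover obtain z where "1 = (x + y) * z"
    using assms(2) by (auto simp: dvd_def)
  ultimately have "1 \<in> I"
    using I_r_closed[of "x + y" z] by (simp add: ring_of_type_algebra_def)
  then show False
    using one_imp_carrier I_notcarr by (simp add: ring_of_type_algebra_def)
qed

lemma unit_inv_unique:
  fixes u :: "'a::comm_ring_1"
  assumes "u * v = 1"
  shows "unit_inv u = v"
  unfolding unit_inv_def
proof (rule the_equality)
  fix v' assume "u * v' = 1"
  have "v' = (u * v) * v'" using assms by simp
  also have "\<dots> = (u * v') * v" by (simp add: ac_simps)
  finally show "v' = v" using \<open>u * v' = 1\<close> by simp
qed (rule assms)

lemma mult_unit_inv:
  fixes u :: "'a::comm_ring_1"
  assumes "u dvd 1"
  shows "u * unit_inv u = 1"
  using assms unit_inv_unique[of u] by (metis dvdE)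

lemma unit_inv_mult_cancel:
  fixes u x :: "'a::comm_ring_1"
  assumes "u dvd 1"
  shows "unit_inv u * (u * x) = x" and "u * (unit_inv u * x) = x"
proof -
  have "u * (unit_inv u * x) = x"
    using mult_unit_inv[OF assms] by (simp add: mult.assoc[symmetric])
  moreover have "unit_inv u * (u * x) = u * (unit_inv u * x)"
    by (rule mult.left_commute)
  ultimately show "unit_inv u * (u * x) = x" and "u * (unit_inv u * x) = x" by simp_all
qed

lemma bij_affine_unit:
  fixes p q :: "'a::comm_ring_1"
  assumes "p dvd 1"
  shows "bij (\<lambda>a. p * a + q)"
proof (rule o_bij)
  note c = unit_inv_mult_cancel[OF assms]
  show "(\<lambda>b. unit_inv p * (b - q)) \<circ> (\<lambda>a. p * a + q) = id"
    by (simp add: fun_eq_iff c)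
  show "(\<lambda>a. p * a + q) \<circ> (\<lambda>b. unit_inv p * (b - q)) = id"
    by (simp add: fun_eq_iff c)
qed

lemma finite_length_eq: "finite {as :: 'a::finite list. length as = n}"
  using finite_lists_length_eq[of "UNIV :: 'a set" n] by simp

lemma card_length_eq: "card {as :: 'a::finite list. length as = n} = CARD('a) ^ n"
  using card_lists_length_eq[of "UNIV :: 'a set" n] by simp

subsection \<open>Entries of the matrices\<close>

lemma elem_mat_nth [simp]:
  "elem_mat a $ 1 $ 1 = a" "elem_mat a $ 1 $ 2 = -1"
  "elem_mat a $ 2 $ 1 = 1" "elem_mat a $ 2 $ 2 = 0"
  by (simp_all add: elem_mat_def)

lemma matrix_mult_2_nth:
  fixes A B :: "'a::comm_ring_1^2^2"
  shows "(A ** B) $ i $ j = A $ i $ 1 * B $ 1 $ j + A $ i $ 2 * B $ 2 $ j"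
  by (simp add: matrix_matrix_mult_def sum_2)

lemma cont_mat_append: "cont_mat (as @ bs) = cont_mat bs ** cont_mat as"
  by (induction as) (simp_all add: matrix_mul_assoc)

lemma det_cont_mat: "det (cont_mat as) = 1"
  by (induction as) (simp_all add: det_mul det_I, simp add: det_2)

lemma cont_mat_det:
  "cont_mat as $ 1 $ 1 * cont_mat as $ 2 $ 2 - cont_mat as $ 1 $ 2 * cont_mat as $ 2 $ 1 = 1"
  using det_cont_mat[of as] by (simp add: det_2)

lemma cont_mat_nonunit_imp_unit:
  fixes as :: "'a::{comm_ring_1,finite} list"
  assumes "local_ring TYPE('a)" and "\<not> cont_mat as $ 1 $ 1 dvd 1"
  shows "cont_mat as $ 1 $ 2 dvd 1"
proof -
  \<comment> \<open>The determinant is written as a sum of two products: one of them is a unit, and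
    so are its factors.\<close>
  have "cont_mat as $ 1 $ 1 * cont_mat as $ 2 $ 2 + cont_mat as $ 1 $ 2 * (- cont_mat as $ 2 $ 1) = 1"
    using cont_mat_det[of as] by simp
  then show ?thesis
    using local_ring_add_unit[OF assms(1)] assms(2) by (metis dvd_mult_left dvd_refl)
qed

text \<open>The unit q is the sum of p a + q and p (- a), and the second summand has the non-unit p
  as a factor.\<close>

lemma unit_affine_nonunit:
  fixes p q a :: "'a::{comm_ring_1,finite}"
  assumes "local_ring TYPE('a)" and "\<not> p dvd 1" and "q dvd 1"
  shows "p * a + q dvd 1"
proof -
  have "(p * a + q) + p * (- a) dvd 1" using assms(3) by simp
  then show ?thesis
    using local_ring_add_unit[OF assms(1)] assms(2) by (metis dvd_mult_left)
qed

subsection \<open>Tuples whose matrix has a unit as upper left entry\<close>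

definition unit_tuples :: "nat \<Rightarrow> 'a::comm_ring_1 list set"
  where "unit_tuples m = {as. length as = m \<and> cont_mat as $ 1 $ 1 dvd 1}"

lemma finite_unit_tuples: "finite (unit_tuples m :: 'a::{comm_ring_1,finite} list set)"
  unfolding unit_tuples_def by (rule finite_subset[OF _ finite_length_eq[of m]]) auto

text \<open>The new upper left entry is p a + q. For a unit p it takes every value exactly once as a
  varies; for a non-unit p it is always a unit.\<close>

lemma card_unit_extensions:
  fixes as :: "'a::{comm_ring_1,finite} list"
  assumes "local_ring TYPE('a)"
  shows "card {a. cont_mat (a # as) $ 1 $ 1 dvd 1} =
    (if cont_mat as $ 1 $ 1 dvd 1 then card (ring_units :: 'a set) else CARD('a))"
proof (cases "cont_mat as $ 1 $ 1 dvd 1")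
  case True
  let ?f = "\<lambda>a. cont_mat as $ 1 $ 1 * a + cont_mat as $ 1 $ 2"
  have "{a. cont_mat (a # as) $ 1 $ 1 dvd 1} = ?f -` ring_units"
    by (auto simp: matrix_mult_2_nth ring_units_def)
  then show ?thesis
    using True bij_affine_unit[OF True, of "cont_mat as $ 1 $ 2"]
    by (simp add: card_vimage_inj bij_is_inj bij_is_surj)
next
  case False
  then have "{a. cont_mat (a # as) $ 1 $ 1 dvd 1} = UNIV"
    using unit_affine_nonunit[OF assms False cont_mat_nonunit_imp_unit[OF assms False]]
    by (auto simp: matrix_mult_2_nth)
  then show ?thesis using False by simp
qed

lemma card_unit_tuples_Suc:
  assumes "local_ring TYPE('a::{comm_ring_1,finite})"
  shows "real (card (unit_tuples (Suc m) :: 'a list set)) =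
    real (card (ring_units :: 'a set)) * real (card (unit_tuples m :: 'a list set)) +
    real CARD('a) * (real CARD('a) ^ m - real (card (unit_tuples m :: 'a list set)))"
proof -
  let ?L = "{as :: 'a list. length as = m}" and ?T = "unit_tuples m :: 'a list set"
  let ?E = "\<lambda>as :: 'a list. {a. cont_mat (a # as) $ 1 $ 1 dvd 1}"
  have T: "?T \<subseteq> ?L" by (auto simp: unit_tuples_def)
  \<comment> \<open>Grouping by the tail makes the count a sum over all tuples of length m.\<close>
  have "unit_tuples (Suc m) = (\<lambda>(as, a). a # as) ` (SIGMA as:?L. ?E as)"
    by (auto simp: unit_tuples_def length_Suc_conv image_iff simp del: cont_mat.simps)
  moreover have "inj_on (\<lambda>(as, a). a # as) (SIGMA as:?L. ?E as)"
    by (auto simp: inj_on_def)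
  ultimately have "card (unit_tuples (Suc m) :: 'a list set) = (\<Sum>as\<in>?L. card (?E as))"
    by (simp add: card_image card_SigmaI finite_length_eq)
  also have "\<dots> = (\<Sum>as\<in>?L. if as \<in> ?T then card (ring_units :: 'a set) else CARD('a))"
    by (intro sum.cong refl) (simp add: card_unit_extensions[OF assms] unit_tuples_def del: cont_mat.simps)
  also have "\<dots> = card (ring_units :: 'a set) * card ?T + CARD('a) * card (?L - ?T)"
    using T by (simp add: sum.If_cases finite_length_eq Int_absorb1 Diff_eq[symmetric])
  finally show ?thesis
    using T card_mono[OF finite_length_eq T]
    by (simp add: card_Diff_subset finite_unit_tuples card_length_eq of_nat_diff)
qed

text \<open>With |U| = q - k the recurrence for the number t(m) becomes t(m+1) = q^(m+1) - k t(m),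
  with t(0) = 1. Its solution is the geometric sum of the q^(m-i) (- k)^i for i from 0 to m; the
  factor q + k puts it in closed form without a division.\<close>

lemma card_unit_tuples:
  assumes "local_ring TYPE('a::{comm_ring_1,finite})"
  defines "q \<equiv> real CARD('a)" and "k \<equiv> real (card (UNIV - ring_units :: 'a set))"
  shows "(q + k) * real (card (unit_tuples m :: 'a list set)) = q ^ Suc m - (- k) ^ Suc m"
proof (induction m)
  case 0
  have "unit_tuples 0 = {[] :: 'a list}"
    by (auto simp: unit_tuples_def mat_def)
  then show ?case by simp
next
  case (Suc m)
  have U: "real (card (ring_units :: 'a set)) = q - k"
    by (simp add: q_def k_def card_Diff_subset of_nat_diff card_mono)
  have "(q + k) * real (card (unit_tuples (Suc m) :: 'a list set)) =
      (q + k) * q ^ Suc m - k * ((q + k) * real (card (unit_tuples m :: 'a list set)))"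
    unfolding card_unit_tuples_Suc[OF assms(1)] U q_def[symmetric] by (simp add: algebra_simps)
  also have "\<dots> = q ^ Suc (Suc m) - (- k) ^ Suc (Suc m)"
    unfolding Suc.IH by (simp add: algebra_simps)
  finally show ?case .
qed

subsection \<open>Tuples with a diagonal matrix\<close>

definition diagonal_tuples :: "nat \<Rightarrow> 'a::comm_ring_1 list set"
  where "diagonal_tuples n =
    {as. length as = n \<and> cont_mat as $ 1 $ 2 = 0 \<and> cont_mat as $ 2 $ 1 = 0}"

text \<open>The sets counted by \<open>w\<close> are disjoint, since the upper left entry recovers
  v. They exhaust the diagonal case, since determinant 1 makes the two diagonal entries inverse to
  each other.\<close>

lemma sum_w_eq_card_diagonal_tuples:
  "(\<Sum>v\<in>ring_units. w n (v :: 'a::{comm_ring_1,finite})) =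
    card (diagonal_tuples n :: 'a list set)"
proof -
  let ?D = "\<lambda>v :: 'a. Omega n (vector [vector [v, 0], vector [0, unit_inv v]])"
  have mem: "as \<in> ?D v \<longleftrightarrow> length as = n \<and> cont_mat as $ 1 $ 1 = v \<and> cont_mat as $ 1 $ 2 = 0 \<and>
      cont_mat as $ 2 $ 1 = 0 \<and> cont_mat as $ 2 $ 2 = unit_inv v" for as v
    by (auto simp: Omega_def vec_eq_iff forall_2)
  have "finite (?D v)" for v
    by (rule finite_subset[OF _ finite_length_eq[of n]]) (auto simp: Omega_def)
  then have "(\<Sum>v\<in>ring_units. card (?D v)) = card (\<Union>v\<in>ring_units. ?D v)"
    by (intro card_UN_disjoint[symmetric]) (auto simp: mem)
  also have "(\<Union>v\<in>ring_units. ?D v) = diagonal_tuples n"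
  proof (intro equalityI subsetI)
    fix as :: "'a list" assume as: "as \<in> diagonal_tuples n"
    then have "cont_mat as $ 1 $ 1 * cont_mat as $ 2 $ 2 = 1"
      using cont_mat_det[of as] by (simp add: diagonal_tuples_def)
    then have "as \<in> ?D (cont_mat as $ 1 $ 1)" "cont_mat as $ 1 $ 1 \<in> ring_units"
      using as unfolding mem
      by (auto simp: diagonal_tuples_def ring_units_def unit_inv_unique intro: dvdI[OF sym])
    then show "as \<in> (\<Union>v\<in>ring_units. ?D v)" by blast
  qed (auto simp: mem diagonal_tuples_def)
  finally show ?thesis by (simp add: w_def)
qed

text \<open>The two conditions for a diagonal matrix decouple: one involves only the last entry b,
  the other only the first entry a.\<close>

lemma cont_mat_Cons_snoc:
  "cont_mat (a # as @ [b]) $ 1 $ 2 = cont_mat as $ 2 $ 1 - b * cont_mat as $ 1 $ 1"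
  "cont_mat (a # as @ [b]) $ 2 $ 1 = cont_mat as $ 1 $ 1 * a + cont_mat as $ 1 $ 2"
  by (simp_all add: cont_mat_append matrix_mult_2_nth)

lemma card_diagonal_tuples:
  assumes "local_ring TYPE('a::{comm_ring_1,finite})"
  shows "card (diagonal_tuples (m + 2) :: 'a list set) = card (unit_tuples m :: 'a list set)"
proof -
  let ?i = "\<lambda>as :: 'a list. unit_inv (cont_mat as $ 1 $ 1)"
  \<comment> \<open>The end entries solve p a + q = 0 and r - b p = 0 for a unit p.\<close>
  let ?g = "\<lambda>as. (- ?i as * cont_mat as $ 1 $ 2) # as @ [?i as * cont_mat as $ 2 $ 1]"
  have "diagonal_tuples (m + 2) = ?g ` unit_tuples m"
  proof (intro equalityI subsetI)
    fix xs :: "'a list" assume xs: "xs \<in> diagonal_tuples (m + 2)"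
    then have "length xs = Suc (Suc m)" by (simp add: diagonal_tuples_def)
    then obtain a ys where "xs = a # ys" "length ys = Suc m"
      by (auto simp: length_Suc_conv)
    then obtain as b where xs_eq: "xs = a # as @ [b]" and len: "length as = m"
      by (auto simp: length_Suc_conv_rev)
    have a: "cont_mat as $ 1 $ 1 * a + cont_mat as $ 1 $ 2 = 0"
      and b: "cont_mat as $ 2 $ 1 = b * cont_mat as $ 1 $ 1"
      using xs cont_mat_Cons_snoc[of a as b]
      unfolding xs_eq diagonal_tuples_def mem_Collect_eq by auto
    have unit: "cont_mat as $ 1 $ 1 dvd 1"
    proof (rule ccontr)
      assume nu: "\<not> cont_mat as $ 1 $ 1 dvd 1"
      have "cont_mat as $ 1 $ 1 * a + cont_mat as $ 1 $ 2 dvd 1"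
        by (rule unit_affine_nonunit[OF assms nu cont_mat_nonunit_imp_unit[OF assms nu]])
      then show False using a by simp
    qed
    note c = unit_inv_mult_cancel[OF unit]
    have "cont_mat as $ 1 $ 1 * a = - cont_mat as $ 1 $ 2"
      using a by (simp add: eq_neg_iff_add_eq_0)
    then have "a = - ?i as * cont_mat as $ 1 $ 2"
      using c(1)[of a] by simp
    moreover have "b = ?i as * cont_mat as $ 2 $ 1"
      using b c(1)[of b] by (simp add: mult.commute)
    ultimately show "xs \<in> ?g ` unit_tuples m"
      using xs_eq unit len by (auto simp: unit_tuples_def)
  next
    fix xs :: "'a list" assume "xs \<in> ?g ` unit_tuples m"
    then obtain as where xs: "xs = ?g as" and as: "length as = m" "cont_mat as $ 1 $ 1 dvd 1"
      by (auto simp: unit_tuples_def)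
    note c = unit_inv_mult_cancel[OF as(2)]
    have "cont_mat as $ 1 $ 1 * (- ?i as * cont_mat as $ 1 $ 2) + cont_mat as $ 1 $ 2 = 0"
      using c(2) by simp
    moreover have "cont_mat as $ 2 $ 1 - ?i as * cont_mat as $ 2 $ 1 * cont_mat as $ 1 $ 1 = 0"
      using c(1)[of "cont_mat as $ 2 $ 1"] by (simp add: ac_simps)
    ultimately show "xs \<in> diagonal_tuples (m + 2)"
      unfolding diagonal_tuples_def mem_Collect_eq xs cont_mat_Cons_snoc using as(1) by simp
  qed
  \<comment> \<open>The inner tuple can be read off by removing both ends.\<close>
  moreover have "inj_on ?g (unit_tuples m)"
    by (auto simp: inj_on_def)
  ultimately show ?thesis by (simp add: card_image)
qed

theorem theorem1p1:
  fixes n :: nat and U :: "'a::{comm_ring_1,finite} set" and \<omega> \<eta> \<tau> :: real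
  assumes "local_ring TYPE('a)"
    and "n \<ge> 3"
    and "U = ring_units"
    and "\<omega> = sqrt (real (card U) ^ 2 + 4 * real (card (UNIV - U)) * real CARD('a))"
    and "\<eta> = (real (card U) + \<omega>) / 2"
    and "\<tau> = (real (card U) - \<omega>) / 2"
  shows "real (\<Sum>v\<in>U. w n v) =
    (real (card U) * \<omega> * (\<tau> ^ (n - 3) + \<eta> ^ (n - 3))
      + (2 * real (card (UNIV - U)) * real CARD('a) + real (card U) ^ 2)
        * (\<eta> ^ (n - 3) - \<tau> ^ (n - 3))) / (2 * \<omega>)"
proof -
  define q where "q = real CARD('a)"
  define k where "k = real (card (UNIV - U))"
  \<comment> \<open>Removing the two ends leaves length l + 1, while l itself is the exponent n -
    3.\<close>
  obtain l where n: "n = Suc l + 2"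
    using assms(2) that[of "n - 3"] by simp
  have U: "real (card U) = q - k"
    by (simp add: q_def k_def card_Diff_subset of_nat_diff card_mono)
  have pos: "q > 0" "k \<ge> 0" by (simp_all add: q_def k_def)
  \<comment> \<open>The radicand is (q - k)^2 + 4 k q, a perfect square.\<close>
  have "\<omega> = sqrt ((q + k)\<^sup>2)"
    unfolding assms(4) U k_def[symmetric] q_def[symmetric]
    by (simp add: power2_eq_square algebra_simps)
  then have \<omega>: "\<omega> = q + k" using pos by simp
  have \<eta>: "\<eta> = q" and \<tau>: "\<tau> = - k"
    by (simp_all add: assms(5,6) U \<omega>)
  have "\<omega> * real (\<Sum>v\<in>U. w n v) = q ^ (l + 2) - (- k) ^ (l + 2)"
    using card_unit_tuples[OF assms(1), of "Suc l"]
    unfolding assms(3) sum_w_eq_card_diagonal_tuples n card_diagonal_tuples[OF assms(1)]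
    by (simp add: \<omega> q_def k_def assms(3))
  \<comment> \<open>The two coefficients are q^2 - k^2 and q^2 + k^2, so the mixed terms cancel and
    2 q^2 \<eta>^l - 2 k^2 \<tau>^l remains.\<close>
  moreover have "real (card U) * \<omega> * (\<tau> ^ l + \<eta> ^ l)
      + (2 * k * q + real (card U) ^ 2) * (\<eta> ^ l - \<tau> ^ l) = 2 * (q ^ (l + 2) - (- k) ^ (l + 2))"
    unfolding U \<omega> \<eta> \<tau> by (simp add: power2_eq_square power_add algebra_simps)
  ultimately have "real (card U) * \<omega> * (\<tau> ^ l + \<eta> ^ l)
      + (2 * k * q + real (card U) ^ 2) * (\<eta> ^ l - \<tau> ^ l) = 2 * (\<omega> * real (\<Sum>v\<in>U. w n v))"
    by (simp only:)
  moreover have "\<omega> \<noteq> 0" using \<omega> pos by simp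
  moreover have "n - 3 = l" using n by simp
  ultimately show ?thesis
    unfolding k_def q_def by simp
qed

end
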